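(* Let $f\in\mathbb R[w_1,\dots,w_d]$ be a polynomial written as $f(w)=\sum_{j=1}^nc_jw^{a_{*j}}$ with $c_j\ne0$ for all $j$ and pairwise distinct exponents $a_{*j}=(a_{1j},\dots,a_{dj})^\top\in\mathbb N_0^d$, and let $g(w)=w^{s-1_d}=\prod_{h=1}^dw_h^{s_h-1}$ with $s\in\mathbb R^d_{>0}$. Define $\lambda_{\mathrm{smplx}}\in(0,\infty]$ by $$\frac1{\lambda_{\mathrm{smplx}}}=\max_{\alpha\in S_{d-1}}\ \min_{j=1,\dots,n}\ \sum_{h=1}^d\alpha_h\frac{a_{hj}}{s_h},$$ where $S_{d-1}=\{\alpha\in\mathbb R^d:\alpha_h\ge0,\ \sum_h\alpha_h=1\}$ and $\lambda_{\mathrm{smplx}}=\infty$ if the right-hand side is $0$. Let $W\subset\mathbb R^d$ be a sufficiently large compact set and let $-\lambda$ be the maximum pole of the (meromorphically continued) zeta function $\zeta(z)=\int_W|f(w)|^z|g(w)|\,dw$. Then $$\lambda\le\lambda_{\mathrm{smplx}} .$$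
   Context: $w^a=\prod_{h=1}^dw_h^{a_h}$; $1_d$ is the all-ones vector. If $\zeta$ has no pole one sets $\lambda=\infty$. "Sufficiently large compact set" means that $W$ may be taken to be a cube $[-M,M]^d$ with $M>0$ sufficiently large. *)

theory Defs
  imports "HOL-Complex_Analysis.Complex_Analysis"
begin

definition monom_nat :: "nat ^ 'd \<Rightarrow> real ^ 'd \<Rightarrow> real"
  where "monom_nat e w = (\<Prod>h\<in>UNIV. (w $ h) ^ (e $ h))"

text \<open>
  The modulus of the monomial with real exponent vector \<open>e\<close>. A real power of a negative number
  has no meaning of its own; only its modulus enters the zeta function, so the modulus is taken
  coordinatewise. On the coordinate hyperplanes (a null set) the value depends on the convention
  \<open>0 powr x = 0\<close>.
\<close>

definition abs_monom_real :: "real ^ 'd \<Rightarrow> real ^ 'd \<Rightarrow> real"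
  where "abs_monom_real e w = (\<Prod>h\<in>UNIV. \<bar>w $ h\<bar> powr (e $ h))"

definition cube :: "real \<Rightarrow> (real ^ 'd) set"
  where "cube M = {w. \<forall>h. - M \<le> w $ h \<and> w $ h \<le> M}"

text \<open>
  The integral \<open>\<integral>\<^sub>W |f(w)|\<^sup>z |g(w)| dw\<close>, where the third argument is the function \<open>|g|\<close>.
  It is meant for \<open>Re z > 0\<close>.
\<close>

definition zeta_integral ::
    "(real ^ 'd) set \<Rightarrow> (real ^ 'd \<Rightarrow> real) \<Rightarrow> (real ^ 'd \<Rightarrow> real) \<Rightarrow> complex \<Rightarrow> complex"
  where "zeta_integral W f absg z =
    (LINT w:W|lborel. complex_of_real \<bar>f w\<bar> powr z * complex_of_real (absg w))"

text \<open>
  A meromorphic continuation is determined only up to its values on a discrete set; poles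
  (in the sense of \<^const>\<open>is_pole\<close>) do not depend on these values.
\<close>

definition meromorphic_continuation :: "(complex \<Rightarrow> complex) \<Rightarrow> (complex \<Rightarrow> complex) \<Rightarrow> bool"
  where "meromorphic_continuation F Z \<longleftrightarrow>
    F meromorphic_on UNIV \<and> (\<forall>z. Re z > 0 \<longrightarrow> F z = Z z)"

text \<open>
  A maximum pole is a real pole such that no pole, real or not, lies to the right of it.
\<close>

definition is_max_pole :: "(complex \<Rightarrow> complex) \<Rightarrow> real \<Rightarrow> bool"
  where "is_max_pole F r \<longleftrightarrow>
    is_pole F (complex_of_real r) \<and> (\<forall>p. is_pole F p \<longrightarrow> Re p \<le> r)"

definition neg_max_pole :: "(complex \<Rightarrow> complex) \<Rightarrow> ereal"
  where "neg_max_pole F =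
    (if \<exists>p. is_pole F p then ereal (- (THE r. is_max_pole F r)) else \<infinity>)"

definition std_simplex :: "(real ^ 'd) set"
  where "std_simplex = {\<alpha>. (\<forall>h. 0 \<le> \<alpha> $ h) \<and> (\<Sum>h\<in>UNIV. \<alpha> $ h) = 1}"

definition weight_min ::
    "nat \<Rightarrow> (nat \<Rightarrow> nat ^ 'd) \<Rightarrow> real ^ 'd \<Rightarrow> real ^ 'd \<Rightarrow> real"
  where "weight_min n a s \<alpha> =
    (MIN j\<in>{1..n}. \<Sum>h\<in>UNIV. \<alpha> $ h * (real (a j $ h) / s $ h))"

text \<open>The supremum is a maximum, see \<open>smplx_value_attained\<close> below.\<close>

definition smplx_value :: "nat \<Rightarrow> (nat \<Rightarrow> nat ^ 'd) \<Rightarrow> real ^ 'd \<Rightarrow> real"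
  where "smplx_value n a s = (SUP \<alpha>\<in>std_simplex. weight_min n a s \<alpha>)"

definition lambda_smplx :: "nat \<Rightarrow> (nat \<Rightarrow> nat ^ 'd) \<Rightarrow> real ^ 'd \<Rightarrow> ereal"
  where "lambda_smplx n a s =
    (if smplx_value n a s = 0 then \<infinity> else ereal (1 / smplx_value n a s))"

lemma compact_std_simplex: "compact (std_simplex :: (real ^ 'd) set)"
proof -
  let ?S = "std_simplex :: (real ^ 'd) set"
  have "closed ?S"
    unfolding std_simplex_def
    by (intro closed_Collect_conj closed_Collect_all closed_Collect_le closed_Collect_eq
        continuous_intros)
  moreover have "bounded ?S"
    unfolding bounded_iff
  proof (intro exI ballI)
    fix x :: "real ^ 'd" assume "x \<in> ?S"
    then have "(\<Sum>h\<in>UNIV. \<bar>x $ h\<bar>) = 1" by (simp add: std_simplex_def)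
    then show "norm x \<le> 1" using norm_le_l1_cart[of x] by simp
  qed
  ultimately show ?thesis by (simp add: compact_eq_bounded_closed)
qed

lemma std_simplex_nonempty: "(std_simplex :: (real ^ 'd) set) \<noteq> {}"
proof -
  have "axis undefined 1 \<in> (std_simplex :: (real ^ 'd) set)"
    by (simp add: std_simplex_def axis_def)
  then show ?thesis by blast
qed

lemma continuous_on_Min_image:
  fixes F :: "'i \<Rightarrow> 'a::topological_space \<Rightarrow> real"
  assumes "finite I" "I \<noteq> {}" "\<And>i. i \<in> I \<Longrightarrow> continuous_on S (F i)"
  shows "continuous_on S (\<lambda>x. Min ((\<lambda>i. F i x) ` I))"
  using assms
proof (induction I rule: finite_ne_induct)
  case (insert i I)
  then have "continuous_on S (\<lambda>x. min (F i x) (Min ((\<lambda>i. F i x) ` I)))"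
    by (intro continuous_on_min) auto
  with insert show ?case by simp
qed simp

lemma smplx_value_attained:
  fixes a :: "nat \<Rightarrow> nat ^ 'd"
  assumes "n \<ge> 1"
  shows "\<exists>\<alpha>\<in>std_simplex. smplx_value n a s = weight_min n a s \<alpha> \<and>
    (\<forall>\<beta>\<in>std_simplex. weight_min n a s \<beta> \<le> weight_min n a s \<alpha>)"
proof -
  have "continuous_on std_simplex (weight_min n a s)"
    unfolding weight_min_def using assms
    by (intro continuous_on_Min_image continuous_intros) auto
  from continuous_attains_sup[OF compact_std_simplex std_simplex_nonempty this]
  obtain \<alpha> where \<alpha>: "\<alpha> \<in> std_simplex"
    "\<forall>\<beta>\<in>std_simplex. weight_min n a s \<beta> \<le> weight_min n a s \<alpha>" by blast
  then have "smplx_value n a s = weight_min n a s \<alpha>"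
    unfolding smplx_value_def by (intro cSup_eq_maximum) auto
  with \<alpha> show ?thesis by blast
qed

end

theory Submission
  imports Defs
begin

text \<open>
  By a Landau-type theorem, a meromorphic function given for \<open>Re z > 0\<close> by the Laplace transform
  of a positive measure has its abscissa of convergence as maximum pole; this applies to \<open>\<zeta>\<close>
  with \<open>- ln |f|\<close> (normalised to be nonnegative) as the variable. So it suffices that
  \<open>\<integral> |f|\<^sup>z |g|\<close> diverges at \<open>z = - 1 / V\<close>, where \<open>V = 1 / \<lambda>\<^sub>s\<^sub>m\<^sub>p\<^sub>l\<^sub>x\<close> is attained at \<open>\<alpha>\<close>. On the boxes
  \<open>B\<^sub>t = {w. \<forall>h. |w\<^sub>h| \<le> t powr (\<alpha>\<^sub>h / s\<^sub>h)}\<close> with \<open>0 < t \<le> 1\<close> one has \<open>|f| \<le> C t powr V\<close>, and \<open>B\<^sub>t\<close> has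
  \<open>|g| dw\<close>-measure proportional to \<open>t\<close>. Hence the integral over \<open>B\<^sub>t\<close> stays bounded away from 0,
  while \<open>B\<^sub>t\<close> shrinks to a null set as \<open>t\<close> tends to 0: the integral cannot be finite.
\<close>

no_notation fps_nth (infixl "$" 75)

section \<open>Landau's theorem for Laplace transforms\<close>

lemma exp_sums_fact: "(\<lambda>k. x ^ k / fact k) sums exp (x :: 'a :: {banach, real_normed_field})"
  using exp_converges[of x] by (simp add: scaleR_conv_of_real divide_inverse mult.commute)

lemma power_div_fact_le_exp:
  assumes "x \<ge> (0::real)" shows "x ^ k / fact k \<le> exp x"
  using sum_le_suminf[of "\<lambda>k. x ^ k / fact k" "{k}"] exp_sums_fact[of x] assms
  by (auto simp: sums_iff)

text \<open>The gap between \<open>y\<close> and \<open>x\<close> pays for the power: a single term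
  of the exponential series of \<open>(x - y) * \<psi> w\<close> is at most its sum, so the
  integrand is at most \<open>exp (- y * \<psi> w) / (x - y) ^ k\<close>.\<close>

lemma laplace_moment_integrable:
  fixes \<psi> :: "'a \<Rightarrow> real"
  assumes [measurable]: "\<psi> \<in> borel_measurable N" and nn: "\<And>w. \<psi> w \<ge> 0"
    and y: "integrable N (\<lambda>w. exp (- y * \<psi> w))" "y < x"
  shows "integrable N (\<lambda>w. \<psi> w ^ k / fact k * exp (- x * \<psi> w))"
proof (rule Bochner_Integration.integrable_bound)
  show "integrable N (\<lambda>w. exp (- y * \<psi> w) / (x - y) ^ k)" using y by simp
  show "AE w in N. norm (\<psi> w ^ k / fact k * exp (- x * \<psi> w)) \<le> norm (exp (- y * \<psi> w) / (x - y) ^ k)"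
  proof (rule AE_I2)
    fix w
    have "(x - y) ^ k * \<psi> w ^ k / fact k \<le> exp ((x - y) * \<psi> w)"
      using power_div_fact_le_exp[of "(x - y) * \<psi> w" k] nn[of w] y by (simp add: power_mult_distrib)
    then have "(x - y) ^ k * \<psi> w ^ k / fact k * exp (- x * \<psi> w) \<le> exp ((x - y) * \<psi> w) * exp (- x * \<psi> w)"
      by (rule mult_right_mono) simp
    also have "\<dots> = exp (- y * \<psi> w)" by (simp add: algebra_simps flip: exp_add)
    finally have "(x - y) ^ k * (\<psi> w ^ k / fact k * exp (- x * \<psi> w)) \<le> exp (- y * \<psi> w)" by simp
    then show "norm (\<psi> w ^ k / fact k * exp (- x * \<psi> w)) \<le> norm (exp (- y * \<psi> w) / (x - y) ^ k)"
      using nn[of w] y by (simp add: pos_le_divide_eq mult_ac)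
  qed
qed auto

text \<open>Expand \<open>exp (- (z - c) * \<psi> w)\<close> under the integral. The moduli of the
  terms sum to at most \<open>exp (- y * \<psi> w)\<close>, because
  \<open>cmod (z - c) - Re c < - y\<close> and \<open>\<psi> \<ge> 0\<close>, and this integrable
  bound justifies the interchange.\<close>

lemma laplace_power_series:
  fixes \<psi> :: "'a \<Rightarrow> real"
  assumes [measurable]: "\<psi> \<in> borel_measurable N" and nn: "\<And>w. \<psi> w \<ge> 0"
    and y: "integrable N (\<lambda>w. exp (- y * \<psi> w))" and z: "cmod (z - c) < Re c - y"
  shows "(\<lambda>k. (\<integral>w. complex_of_real (- \<psi> w) ^ k / fact k * exp (- c * of_real (\<psi> w)) \<partial>N) * (z - c) ^ k)
    sums (\<integral>w. exp (- z * of_real (\<psi> w)) \<partial>N)"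
proof -
  define f where "f k w = complex_of_real (- \<psi> w) ^ k / fact k * exp (- c * of_real (\<psi> w)) * (z - c) ^ k" for k w
  have f_eq: "f k w = (- (z - c) * of_real (\<psi> w)) ^ k / fact k * exp (- c * of_real (\<psi> w))" for k w
    by (simp add: f_def power_mult_distrib[symmetric] algebra_simps minus_mult_commute)
  have [measurable]: "f k \<in> borel_measurable N" for k unfolding f_def by measurable
  have norm_f: "norm (f k w) = (cmod (z - c) * \<psi> w) ^ k / fact k * exp (- Re c * \<psi> w)" for k w
    using nn[of w] by (simp add: f_eq norm_mult norm_divide norm_power norm_minus_commute[of c z])
  have sums_norm: "(\<lambda>k. norm (f k w)) sums (exp (cmod (z - c) * \<psi> w) * exp (- Re c * \<psi> w))" for w
    unfolding norm_f by (intro sums_mult2 exp_sums_fact)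
  have sums_f: "(\<lambda>k. f k w) sums exp (- z * of_real (\<psi> w))" for w
  proof -
    have "(\<lambda>k. f k w) sums (exp (- (z - c) * of_real (\<psi> w)) * exp (- c * of_real (\<psi> w)))"
      unfolding f_eq by (intro sums_mult2 exp_sums_fact)
    then show ?thesis by (simp add: algebra_simps flip: exp_add)
  qed
  have le: "exp (cmod (z - c) * \<psi> w) * exp (- Re c * \<psi> w) \<le> exp (- y * \<psi> w)" for w
    using mult_right_mono[of "cmod (z - c)" "Re c - y" "\<psi> w"] nn[of w] z
    by (simp add: algebra_simps flip: exp_add)
  have sum_le: "(\<Sum>k<n. norm (f k w)) \<le> exp (- y * \<psi> w)" for n w
    using sum_le_suminf[OF sums_summable[OF sums_norm[of w]], of "{..<n}"] sums_norm[of w] le[of w]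
    by (auto simp: sums_iff)
  have int: "integrable N (f k)" for k
  proof (rule Bochner_Integration.integrable_bound[OF y])
    show "AE w in N. norm (f k w) \<le> norm (exp (- y * \<psi> w))"
      using order_trans[OF member_le_sum sum_le, of k "Suc k"] by auto
  qed simp
  have "summable (\<lambda>k. \<integral>w. norm (f k w) \<partial>N)"
  proof (rule bounded_imp_summable)
    fix n
    have "(\<Sum>k\<le>n. \<integral>w. norm (f k w) \<partial>N) = (\<integral>w. (\<Sum>k\<le>n. norm (f k w)) \<partial>N)"
      using int by (subst Bochner_Integration.integral_sum) auto
    also have "\<dots> \<le> (\<integral>w. exp (- y * \<psi> w) \<partial>N)"
      using int y sum_le[where n = "Suc n"] by (intro integral_mono) (auto simp: lessThan_Suc_atMost)
    finally show "(\<Sum>k\<le>n. \<integral>w. norm (f k w) \<partial>N) \<le> (\<integral>w. exp (- y * \<psi> w) \<partial>N)" .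
  qed auto
  then have "(\<lambda>k. \<integral>w. f k w \<partial>N) sums (\<integral>w. (\<Sum>k. f k w) \<partial>N)"
    using int sums_norm by (intro sums_integral) (auto simp: sums_iff)
  also have "(\<lambda>w. \<Sum>k. f k w) = (\<lambda>w. exp (- z * of_real (\<psi> w)))"
    using sums_f by (auto simp: sums_iff)
  finally show ?thesis unfolding f_def integral_mult_left_zero .
qed

text \<open>A converse to the expansion: at \<open>x - r\<close>, to the left of the centre
  \<open>x\<close>, all terms are nonnegative, so convergence of the integrated series alone makes
  the sum \<open>exp (- (x - r) * \<psi> w)\<close> integrable. This positivity is the core of
  Landau's theorem.\<close>

lemma laplace_integrable_of_moments:
  fixes \<psi> :: "'a \<Rightarrow> real"
  assumes [measurable]: "\<psi> \<in> borel_measurable N" and nn: "\<And>w. \<psi> w \<ge> 0" and r: "r \<ge> 0"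
    and int: "\<And>k. integrable N (\<lambda>w. \<psi> w ^ k / fact k * exp (- x * \<psi> w))"
    and sums: "summable (\<lambda>k. (\<integral>w. \<psi> w ^ k / fact k * exp (- x * \<psi> w) \<partial>N) * r ^ k)"
  shows "integrable N (\<lambda>w. exp (- (x - r) * \<psi> w))"
proof -
  define f where "f k w = \<psi> w ^ k / fact k * exp (- x * \<psi> w) * r ^ k" for k w
  have f0: "f k w \<ge> 0" for k w using nn[of w] r by (simp add: f_def)
  have sums_f: "(\<lambda>k. f k w) sums exp (- (x - r) * \<psi> w)" for w
  proof -
    have "(\<lambda>k. (r * \<psi> w) ^ k / fact k * exp (- x * \<psi> w)) sums (exp (r * \<psi> w) * exp (- x * \<psi> w))"
      by (intro sums_mult2 exp_sums_fact)
    then show ?thesis by (simp add: f_def algebra_simps power_mult_distrib flip: exp_add)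
  qed
  have "integrable N (\<lambda>w. \<Sum>k. f k w)"
  proof (rule integrable_suminf)
    show "integrable N (f k)" for k unfolding f_def using int by (intro integrable_mult_left)
    show "AE w in N. summable (\<lambda>k. norm (f k w))"
      using sums_f f0 by (auto simp: sums_iff)
    show "summable (\<lambda>k. \<integral>w. norm (f k w) \<partial>N)"
      unfolding real_norm_def abs_of_nonneg[OF f0] using sums
      unfolding f_def integral_mult_left_zero .
  qed
  then show ?thesis using sums_f by (simp add: sums_iff)
qed

lemma power_series_coeffs_unique:
  fixes a b :: "nat \<Rightarrow> complex"
  assumes "r > 0" and "\<And>z. z \<in> ball c r \<Longrightarrow> (\<lambda>k. a k * (z - c) ^ k) sums f z"
    and "\<And>z. z \<in> ball c r \<Longrightarrow> (\<lambda>k. b k * (z - c) ^ k) sums f z"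
  shows "a = b"
proof -
  have "(\<lambda>u. f (c + u)) has_fps_expansion Abs_fps d"
    if "\<And>z. z \<in> ball c r \<Longrightarrow> (\<lambda>k. d k * (z - c) ^ k) sums f z" for d
  proof (rule has_fps_expansionI)
    have "eventually (\<lambda>u. u \<in> ball 0 r) (nhds (0 :: complex))"
      using \<open>r > 0\<close> by (intro eventually_nhds_in_open) auto
    then show "eventually (\<lambda>u. (\<lambda>k. fps_nth (Abs_fps d) k * u ^ k) sums f (c + u)) (nhds 0)"
    proof eventually_elim
      case (elim u)
      then show ?case using that[of "c + u"] by (simp add: dist_norm)
    qed
  qed
  from fps_expansion_unique_complex[OF this[OF assms(2)] this[OF assms(3)]]
  show ?thesis by (simp add: Abs_fps_inject)
qed

text \<open>Identity theorem: \<open>F - G\<close>, with its singularities removed, vanishes near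
  \<open>z0\<close> and hence on the connected set \<open>A\<close>. So \<open>F\<close> has the
  finite limit \<open>G z\<close> at every \<open>z\<close> in \<open>A\<close>, which excludes a
  pole.\<close>

lemma meromorphic_eq_analytic_imp_no_pole:
  assumes F: "F meromorphic_on A" and G: "G holomorphic_on A" and A: "open A" "connected A"
    and z0: "z0 \<in> A" and eq: "eventually (\<lambda>z. F z = G z) (at z0)" and z: "z \<in> A"
  shows "remove_sings F z = G z" "\<not> is_pole F z"
proof -
  have G': "G analytic_on A" using G A by (simp add: analytic_on_open)
  have mero: "(\<lambda>z. F z - G z) meromorphic_on A"
    by (rule meromorphic_on_diff[OF F analytic_on_imp_meromorphic_on[OF G']])
  have iso: "isolated_singularity_at (\<lambda>z. F z - G z) z" if "z \<in> A" for z
    using mero that by (meson meromorphic_on_isolated_singularity meromorphic_on_subset empty_subsetI insert_subsetI)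
  have "eventually (\<lambda>z. remove_sings (\<lambda>z. F z - G z) z = 0) (at z0)"
    using eventually_remove_sings_eq_at[OF iso[OF z0]] eq by eventually_elim auto
  then have "frequently (\<lambda>z. remove_sings (\<lambda>z. F z - G z) z = 0) (at z0)"
    by (intro eventually_frequently) auto
  from frequently_eq_meromorphic_imp_constant[OF this remove_sings_nicely_meromorphic[OF mero] A z0]
  have 0: "remove_sings (\<lambda>z. F z - G z) w = 0" if "w \<in> A" for w using that .
  have "eventually (\<lambda>w. w \<in> A) (at z)" using A z by (simp add: eventually_at_in_open')
  with eventually_remove_sings_eq_at[OF iso[OF z]]
  have ev: "eventually (\<lambda>w. G w = F w) (at z)"
    by eventually_elim (use 0 in fastforce)
  have "G \<midarrow>z\<rightarrow> G z"
    using G' z A by (meson analytic_at_imp_isCont analytic_on_analytic_at isContD)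
  then have lim: "F \<midarrow>z\<rightarrow> G z" using ev by (rule Lim_transform_eventually)
  then show "remove_sings F z = G z" by (rule remove_sings_eqI)
  from lim show "\<not> is_pole F z"
    unfolding is_pole_def by (meson at_neq_bot not_tendsto_and_filterlim_at_infinity)
qed

text \<open>The witness is the abscissa of convergence \<open>\<sigma>\<close>. To its right
  \<open>F\<close> agrees with the holomorphic transform \<open>G\<close> up to removable
  singularities; if \<open>\<sigma>\<close> were not a pole, the integral would converge beyond
  \<open>\<sigma>\<close>.\<close>

lemma laplace_meromorphic_max_pole:
  fixes \<psi> :: "'a \<Rightarrow> real"
  assumes N: "finite_measure N"
    and [measurable]: "\<psi> \<in> borel_measurable N" and nn: "\<And>w. \<psi> w \<ge> 0"
    and F: "F meromorphic_on UNIV"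
    and F_eq: "\<And>z. Re z > 0 \<Longrightarrow> F z = (\<integral>w. exp (- z * of_real (\<psi> w)) \<partial>N)"
    and x0: "\<not> integrable N (\<lambda>w. exp (- x0 * \<psi> w))"
  shows "\<exists>r\<ge>x0. is_max_pole F r"
proof -
  interpret N: finite_measure N by fact
  define A where "A = {x. integrable N (\<lambda>w. exp (- x * \<psi> w))}"
  define G where "G z = (\<integral>w. exp (- z * complex_of_real (\<psi> w)) \<partial>N)" for z
  have up: "y \<in> A" if "x \<in> A" "x \<le> y" for x y
    unfolding A_def mem_Collect_eq
  proof (rule Bochner_Integration.integrable_bound)
    show "integrable N (\<lambda>w. exp (- x * \<psi> w))" using that by (simp add: A_def)
    show "AE w in N. norm (exp (- y * \<psi> w)) \<le> norm (exp (- x * \<psi> w))"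
      using that nn by (auto intro!: mult_right_mono)
  qed simp
  have A0: "0 \<in> A" by (simp add: A_def)
  have x0A: "x0 \<le> x" if "x \<in> A" for x
    by (rule ccontr) (use x0 up[OF that, of x0] in \<open>simp add: A_def\<close>)
  define \<sigma> where "\<sigma> = Inf A"
  have bdd: "bdd_below A" using x0A by (rule bdd_belowI)
  \<comment> \<open>Finiteness of \<open>N\<close> puts 0 into \<open>A\<close>, and divergence at
    \<open>x0\<close> bounds \<open>A\<close> below, so the abscissa is a real number.\<close>
  have \<sigma>: "x0 \<le> \<sigma>" "\<sigma> \<le> 0"
    using A0 x0A bdd by (auto simp: \<sigma>_def intro: cInf_greatest cInf_lower)
  have inA: "x \<in> A" if "x > \<sigma>" for x
    using cInf_lessD[of A x] A0 that up by (force simp: \<sigma>_def)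
  have notinA: "x \<notin> A" if "x < \<sigma>" for x
    using that bdd cInf_lower[of x A] by (auto simp: \<sigma>_def)
  define m where "m c k = (\<integral>w. complex_of_real (- \<psi> w) ^ k / fact k * exp (- c * of_real (\<psi> w)) \<partial>N)" for c k
  have G_sums: "(\<lambda>k. m c k * (z - c) ^ k) sums G z" if "z \<in> ball c (Re c - \<sigma>)" for z c
  proof -
    have "\<sigma> < Re c - cmod (z - c)" using that by (simp add: dist_norm norm_minus_commute)
    then obtain y where y: "\<sigma> < y" "y < Re c - cmod (z - c)" using dense by blast
    then show ?thesis unfolding m_def G_def
      using nn inA[OF y(1)]
      by (intro laplace_power_series[of _ _ y]) (simp_all add: A_def)
  qed
  let ?H = "{z. Re z > \<sigma>}"
  have H: "open ?H" "connected ?H"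
    by (simp_all add: open_halfspace_Re_gt convex_connected convex_halfspace_Re_gt)
  have G_holo: "G holomorphic_on ?H"
  proof -
    have "G analytic_on {c}" if "c \<in> ?H" for c
    proof -
      have "G analytic_on ball c (Re c - \<sigma>)"
        by (rule power_series_analytic[OF G_sums])
      then show ?thesis using that by (auto elim: analytic_on_subset)
    qed
    then show ?thesis using H analytic_on_analytic_at analytic_on_open by blast
  qed
  have "eventually (\<lambda>z. z \<in> {z. Re z > 0}) (at 1)"
    by (intro eventually_at_in_open') (auto simp: open_halfspace_Re_gt)
  then have ev: "eventually (\<lambda>z. F z = G z) (at 1)"
    by eventually_elim (simp add: F_eq G_def)
  have F_H: "F meromorphic_on ?H" using F by (rule meromorphic_on_subset) auto
  have one: "1 \<in> ?H" using \<sigma> by simp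
  note FG = meromorphic_eq_analytic_imp_no_pole[OF F_H G_holo H one ev]
  have pole_\<sigma>: "is_pole F (of_real \<sigma>)"
  proof (rule ccontr)
    assume np: "\<not> is_pole F (of_real \<sigma>)"
    \<comment> \<open>The values of \<open>F\<close> at removable singularities are arbitrary;
      \<open>R\<close> corrects them and so is analytic wherever \<open>F\<close> has no
      pole.\<close>
    define R where "R = remove_sings F"
    have R: "R nicely_meromorphic_on UNIV" unfolding R_def by (rule remove_sings_nicely_meromorphic[OF F])
    have iso: "isolated_singularity_at F z" for z
      using F meromorphic_on_isolated_singularity meromorphic_on_subset by blast
    have R_ana: "R analytic_on {z}" if "\<not> is_pole F z" for z
      by (rule nicely_meromorphic_on_imp_analytic_at[OF R])
        (use that iso in \<open>simp_all add: R_def\<close>)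
    obtain e where e: "e > 0" "R holomorphic_on ball (of_real \<sigma>) e"
      using R_ana[OF np] by (auto simp: analytic_at_ball)
    \<comment> \<open>The disc around \<open>\<sigma> + 1\<close> reaches beyond \<open>\<sigma>\<close>, so the Taylor series at \<open>\<sigma> + 1\<close>, whose terms are
      of one sign to the left of the centre, forces convergence of the integral below \<open>\<sigma>\<close>.\<close>
    define c where "c = complex_of_real (\<sigma> + 1)"
    \<comment> \<open>This is the distance from \<open>c\<close> to the two points where the line
      \<open>Re z = \<sigma>\<close> meets the circle of radius \<open>e\<close> about
      \<open>\<sigma>\<close>. So the disc of radius \<open>\<rho>\<close> leaves the half-plane
      only inside the small ball.\<close>
    define \<rho> where "\<rho> = sqrt (1 + e\<^sup>2)"
    have \<rho>: "\<rho> > 1" using e by (simp add: \<rho>_def)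
    have sub: "z \<in> ?H \<union> ball (of_real \<sigma>) e" if "z \<in> ball c \<rho>" for z
    proof (cases "Re z > \<sigma>")
      case False
      have "(cmod (z - c))\<^sup>2 < \<rho>\<^sup>2"
        using that by (intro power_strict_mono) (auto simp: dist_norm norm_minus_commute)
      then have "(Re z - (\<sigma> + 1))\<^sup>2 + (Im z)\<^sup>2 < 1 + e\<^sup>2"
        by (simp add: \<rho>_def c_def cmod_power2)
      moreover have "(Re z - (\<sigma> + 1))\<^sup>2 = (Re z - \<sigma>)\<^sup>2 + 1 - 2 * (Re z - \<sigma>)"
        by (simp add: power2_eq_square algebra_simps)
      moreover have "(cmod (z - of_real \<sigma>))\<^sup>2 = (Re z - \<sigma>)\<^sup>2 + (Im z)\<^sup>2"
        by (simp add: cmod_power2)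
      \<comment> \<open>With \<open>d = Re z - \<sigma> \<le> 0\<close>, the squared distance to
        \<open>\<sigma>\<close> is the squared distance to \<open>c\<close> minus 1 plus
        \<open>2 * d\<close>. The squares are abstracted to variables to leave a linear
        problem.\<close>
      moreover have "W < E" if "A + B < 1 + E" "A = X + 1 - 2 * d" "W = X + B" "d \<le> 0" for A B E X d W :: real
        using that by linarith
      ultimately have "(cmod (z - of_real \<sigma>))\<^sup>2 < e\<^sup>2"
        using False by simp
      then have "cmod (z - of_real \<sigma>) < e"
        by (rule power_less_imp_less_base) (use e in simp)
      then show ?thesis by (simp add: dist_norm norm_minus_commute)
    qed auto
    have "R analytic_on ball c \<rho>"
      unfolding analytic_on_analytic_at[of _ "ball c \<rho>"]
    proof
      fix z assume "z \<in> ball c \<rho>"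
      with sub consider "z \<in> ?H" | "z \<in> ball (of_real \<sigma>) e" by blast
      then show "R analytic_on {z}"
      proof cases
        case 1 then show ?thesis using FG(2) R_ana by blast
      next
        case 2 then show ?thesis
          using e(2) by (auto simp: analytic_on_open[symmetric] elim: analytic_on_subset)
      qed
    qed
    then have R_sums: "(\<lambda>k. (deriv ^^ k) R c / fact k * (z - c) ^ k) sums R z" if "z \<in> ball c \<rho>" for z
      using that by (simp add: analytic_iff_power_series)
    \<comment> \<open>The unit disc about \<open>c\<close> stays in the half-plane, where
      \<open>R\<close> equals \<open>G\<close>. So the \<open>m c k\<close> are the Taylor
      coefficients of \<open>R\<close>, and their series converges on the larger disc.\<close>
    have "(\<lambda>k. (deriv ^^ k) R c / fact k) = m c"
    proof (rule power_series_coeffs_unique[of 1 c _ R])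
      fix z assume z: "z \<in> ball c 1"
      then show "(\<lambda>k. (deriv ^^ k) R c / fact k * (z - c) ^ k) sums R z"
        using \<rho> by (intro R_sums) auto
      have "\<bar>Re (c - z)\<bar> < 1" using abs_Re_le_cmod[of "c - z"] z by (simp add: dist_norm)
      then have "z \<in> ?H" by (simp add: c_def)
      then have "R z = G z" using FG(1) by (simp add: R_def)
      then show "(\<lambda>k. m c k * (z - c) ^ k) sums R z"
        using z by (simp add: G_sums c_def)
    qed simp
    then have coeff: "(deriv ^^ k) R c / fact k = m c k" for k by metis
    \<comment> \<open>Any \<open>r\<close> strictly between 1 and \<open>\<rho>\<close> serves:
      \<open>c - r\<close> is then left of \<open>\<sigma>\<close> but still inside the
      disc.\<close>
    define r where "r = (1 + \<rho>) / 2"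
    have r: "1 < r" "r < \<rho>" using \<rho> by (auto simp: r_def)
    define M where "M k = (\<integral>w. \<psi> w ^ k / fact k * exp (- (\<sigma> + 1) * \<psi> w) \<partial>N)" for k
    \<comment> \<open>The sign from \<open>(- \<psi> w) ^ k\<close> cancels the one from evaluating
      at \<open>c - r\<close>, which leaves a series of nonnegative terms.\<close>
    have m_M: "m c k * (- of_real r) ^ k = of_real (M k * r ^ k)" for k
    proof -
      have "m c k = (\<integral>w. complex_of_real ((-1) ^ k * (\<psi> w ^ k / fact k * exp (- (\<sigma> + 1) * \<psi> w))) \<partial>N)"
        unfolding m_def c_def
        by (intro Bochner_Integration.integral_cong)
          (auto simp: power_minus[of "of_real _"] exp_of_real[symmetric])
      also have "\<dots> = of_real ((-1) ^ k * M k)"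
        unfolding integral_complex_of_real M_def by simp
      finally have "m c k * (- of_real r) ^ k = of_real (((-1) ^ k * (-1) ^ k) * (M k * r ^ k))"
        by (simp add: power_minus[of "of_real r"])
      then show ?thesis by (simp flip: power_mult_distrib)
    qed
    have "summable (\<lambda>k. m c k * (- of_real r) ^ k)"
      using R_sums[of "c - of_real r"] r by (auto simp: coeff dist_norm sums_iff)
    then have "summable (\<lambda>k. M k * r ^ k)"
      unfolding m_M by (simp only: summable_of_real_iff)
    moreover have "integrable N (\<lambda>w. \<psi> w ^ k / fact k * exp (- (\<sigma> + 1) * \<psi> w))" for k
    proof (rule laplace_moment_integrable[OF _ nn])
      show "integrable N (\<lambda>w. exp (- (\<sigma> + 1/2) * \<psi> w))"
        using inA[of "\<sigma> + 1/2"] unfolding A_def mem_Collect_eq by linarith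
    qed auto
    ultimately have "integrable N (\<lambda>w. exp (- (\<sigma> + 1 - r) * \<psi> w))"
      using r nn by (intro laplace_integrable_of_moments) (auto simp: M_def)
    then have "\<sigma> + 1 - r \<in> A" by (simp only: A_def mem_Collect_eq)
    moreover have "\<sigma> + 1 - r \<notin> A" using r by (intro notinA) auto
    ultimately show False by blast
  qed
  have "is_max_pole F \<sigma>"
    unfolding is_max_pole_def using pole_\<sigma> FG(2) by (auto simp: not_le[symmetric])
  with \<sigma> show ?thesis by blast
qed

section \<open>The zero set of a polynomial is a null set\<close>

text \<open>The weights are powers of \<open>B\<close>: the weighted sum has the \<open>e h\<close> as its base-\<open>B\<close> digits.\<close>

lemma separating_weights_exist:
  fixes B :: nat
  assumes "finite H"
  shows "\<exists>k :: 'h \<Rightarrow> nat. \<forall>e e'. (\<forall>h\<in>H. e h < B \<and> e' h < B) \<longrightarrow>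
    (\<Sum>h\<in>H. k h * e h) = (\<Sum>h\<in>H. k h * e' h) \<longrightarrow> (\<forall>h\<in>H. e h = e' h)"
  using assms
proof (induction H rule: finite_induct)
  case empty
  then show ?case by simp
next
  case (insert x H)
  then obtain k :: "'h \<Rightarrow> nat" where k: "\<forall>e e'. (\<forall>h\<in>H. e h < B \<and> e' h < B) \<longrightarrow>
    (\<Sum>h\<in>H. k h * e h) = (\<Sum>h\<in>H. k h * e' h) \<longrightarrow> (\<forall>h\<in>H. e h = e' h)" by blast
  define k' where "k' h = (if h = x then 1 else B * k h)" for h
  have sum: "(\<Sum>h\<in>insert x H. k' h * e h) = e x + B * (\<Sum>h\<in>H. k h * e h)" for e
  proof -
    have "(\<Sum>h\<in>H. k' h * e h) = (\<Sum>h\<in>H. B * (k h * e h))"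
      using insert by (intro sum.cong) (auto simp: k'_def)
    with insert show ?thesis by (simp add: k'_def sum_distrib_left)
  qed
  show ?case
  proof (intro exI[of _ k'] allI impI)
    fix e e' assume B: "\<forall>h\<in>insert x H. e h < B \<and> e' h < B"
      and eq: "(\<Sum>h\<in>insert x H. k' h * e h) = (\<Sum>h\<in>insert x H. k' h * e' h)"
    then have eq: "e x + B * (\<Sum>h\<in>H. k h * e h) = e' x + B * (\<Sum>h\<in>H. k h * e' h)"
      by (simp only: sum)
    \<comment> \<open>\<open>mod B\<close> reads off the lowest digit \<open>e x\<close>; after it
      the factor \<open>B\<close> cancels, being positive because \<open>e x < B\<close>.\<close>
    from arg_cong[OF eq, of "\<lambda>n. n mod B"] B have "e x = e' x" by simp
    moreover from this eq have "(\<Sum>h\<in>H. k h * e h) = (\<Sum>h\<in>H. k h * e' h)"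
      using B by simp
    with k B have "\<forall>h\<in>H. e h = e' h" by simp
    ultimately show "\<forall>h\<in>insert x H. e h = e' h" by simp
  qed
qed

lemma continuous_on_monom_nat [continuous_intros]: "continuous_on A (monom_nat e)"
  unfolding monom_nat_def by (intro continuous_intros)

lemma AE_vec_nth_nonzero:
  fixes h :: "'d::finite"
  shows "AE u in lborel. u $ h \<noteq> (0::real)"
proof -
  have "axis h 1 \<in> (Basis :: (real ^ 'd) set)" by simp
  then have "negligible {u :: real ^ 'd. u \<bullet> axis h 1 = 0}" by (rule negligible_standard_hyperplane)
  moreover have "{u :: real ^ 'd. u \<bullet> axis h 1 = 0} = {u. u $ h = 0}"
    by (simp add: inner_axis)
  moreover have "{u :: real ^ 'd. u $ h = 0} \<in> sets borel" by measurable
  ultimately have "{u :: real ^ 'd. u $ h = 0} \<in> null_sets lborel"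
    by (simp add: negligible_iff_null_sets null_sets_completion_iff)
  then show ?thesis by (rule AE_I') auto
qed

text \<open>
  Along a curve \<open>t \<mapsto> (t^k\<^sub>h u\<^sub>h)\<^sub>h\<close> with separating weights \<open>k\<close> the monomials become distinct powers of
  \<open>t\<close>, so almost every curve meets the zero set finitely often. By Fubini, some dilation
  \<open>u \<mapsto> (t^k\<^sub>h u\<^sub>h)\<^sub>h\<close> has a null set as preimage of the zero set.
\<close>

lemma AE_sum_monom_nat_nonzero:
  fixes a :: "nat \<Rightarrow> nat ^ 'd" and c :: "nat \<Rightarrow> real"
  assumes n: "n \<ge> 1" and c: "\<And>j. j \<in> {1..n} \<Longrightarrow> c j \<noteq> 0" and inj: "inj_on a {1..n}"
  shows "AE w in lborel. (\<Sum>j=1..n. c j * monom_nat (a j) w) \<noteq> 0"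
proof -
  define f where "f w = (\<Sum>j=1..n. c j * monom_nat (a j) w)" for w
  have contf: "continuous_on A f" for A unfolding f_def by (intro continuous_intros)
  define B where "B = Suc (Max ((\<lambda>(j,h). a j $ h) ` ({1..n} \<times> UNIV)))"
  have B: "a j $ h < B" if "j \<in> {1..n}" for j h
    unfolding B_def using that by (intro le_imp_less_Suc Max_ge) auto
  obtain k :: "'d \<Rightarrow> nat" where k: "\<And>e e'. (\<forall>h. e h < B \<and> e' h < B) \<Longrightarrow>
    (\<Sum>h\<in>UNIV. k h * e h) = (\<Sum>h\<in>UNIV. k h * e' h) \<Longrightarrow> (\<forall>h. e h = e' h)"
    using separating_weights_exist[of "UNIV :: 'd set" B] by auto
  define m where "m j = (\<Sum>h\<in>UNIV. k h * a j $ h)" for j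
  have inj_m: "inj_on m {1..n}"
  proof (rule inj_onI)
    fix i j assume ij: "i \<in> {1..n}" "j \<in> {1..n}" "m i = m j"
    then have "\<forall>h. a i $ h = a j $ h" using B by (intro k) (auto simp: m_def)
    then have "a i = a j" by (simp add: vec_eq_iff)
    with inj ij show "i = j" by (auto dest: inj_onD)
  qed
  define D :: "real \<Rightarrow> real ^ 'd \<Rightarrow> real ^ 'd" where "D t u = (\<chi> h. t ^ k h * u $ h)" for t u
  have fD: "f (D t u) = (\<Sum>j=1..n. c j * monom_nat (a j) u * t ^ m j)" for t u
    by (simp add: f_def D_def monom_nat_def power_mult_distrib prod.distrib m_def power_sum
        flip: power_mult) (simp add: mult_ac)
  have contD: "continuous_on UNIV (\<lambda>(t, u). D t u)"
    unfolding D_def split_beta by (intro continuous_intros)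
  have fin: "finite {t. f (D t u) = 0}" if u: "\<And>h. u $ h \<noteq> 0" for u
  proof -
    define p where "p = (\<Sum>j=1..n. monom (c j * monom_nat (a j) u) (m j))"
    \<comment> \<open>Since \<open>m\<close> is injective, no other monomial contributes in degree
      \<open>m 1\<close>, so nothing can cancel this coefficient, which is nonzero off the
      coordinate hyperplanes.\<close>
    have "coeff p (m 1) = (\<Sum>j=1..n. if j = 1 then c j * monom_nat (a j) u else 0)"
      unfolding p_def coeff_sum using inj_m n
      by (intro sum.cong) (auto simp: inj_on_eq_iff)
    also have "\<dots> = c 1 * monom_nat (a 1) u" using n by simp
    also have "\<dots> \<noteq> 0" using c[of 1] n u by (simp add: monom_nat_def)
    finally have "p \<noteq> 0" by auto
    then have "finite {t. poly p t = 0}" by (rule poly_roots_finite)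
    moreover have "poly p t = f (D t u)" for t
      by (simp add: p_def poly_sum poly_monom fD)
    ultimately show ?thesis by simp
  qed
  have "AE u in lborel. \<forall>h. u $ h \<noteq> (0::real)"
    using AE_vec_nth_nonzero by (subst AE_all_countable) auto
  then have "AE u in lborel. AE t in lborel. f (D t u) \<noteq> 0"
  proof eventually_elim
    case (elim u)
    then have "{t. f (D t u) = 0} \<in> null_sets lborel"
      by (intro finite_imp_null_set_lborel fin) auto
    then show ?case by (rule AE_I') auto
  qed
  moreover have "continuous_on UNIV (\<lambda>p. f (D (fst p) (snd p)))"
    using continuous_on_compose2[OF contf[of UNIV] contD] by (simp add: split_beta)
  then have "(\<lambda>p. f (D (fst p) (snd p))) \<in> borel_measurable borel"
    by (rule borel_measurable_continuous_onI)
  then have "{p \<in> space (lborel \<Otimes>\<^sub>M lborel). f (D (fst p) (snd p)) \<noteq> 0} \<in> sets (lborel \<Otimes>\<^sub>M lborel)"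
    unfolding lborel_prod by simp
  ultimately have "AE t in lborel. AE u in lborel. f (D t u) \<noteq> 0"
    by (subst lborel_pair.AE_commute) auto
  \<comment> \<open>A non-null interval of positive numbers must contain a \<open>t\<close> from the
    almost-everywhere statement; \<open>t > 0\<close> makes the dilation \<open>D t\<close>
    invertible.\<close>
  moreover have "\<not> (AE t in lborel. t \<notin> {1<..<2::real})"
    by (subst AE_iff_null_sets[symmetric]) auto
  ultimately obtain t where t: "t > 0" "AE u in lborel. f (D t u) \<noteq> 0"
    by (smt (verit) eventually_mono greaterThanLessThan_iff)
  have contDt: "continuous_on UNIV (D t)"
    unfolding D_def by (intro continuous_intros)
  have "continuous_on UNIV (\<lambda>u. f (D t u))"
    by (rule continuous_on_compose2[OF contf contDt]) auto
  then have "closed {u. f (D t u) = 0}"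
    by (intro closed_Collect_eq) auto
  then have meas: "{u. f (D t u) = 0} \<in> sets lborel" by simp
  have "linear (D t)"
    by (rule linearI) (simp_all add: D_def vec_eq_iff algebra_simps)
  have "{u. f (D t u) = 0} \<in> null_sets lborel"
    using t(2) meas by (simp add: AE_iff_null_sets)
  then have "negligible {u. f (D t u) = 0}"
    by (simp add: negligible_iff_null_sets null_sets_completionI)
  then have "negligible (D t ` {u. f (D t u) = 0})"
    using \<open>linear (D t)\<close>
    by (intro negligible_differentiable_image_negligible linear_imp_differentiable_on) auto
  \<comment> \<open>\<open>D t\<close> is onto, so the image of the preimage is the whole zero set;
    it is null because linear maps send null sets to null sets.\<close>
  moreover have "D t ` {u. f (D t u) = 0} = {w. f w = 0}"
  proof -
    have "w = D t (\<chi> h. w $ h / t ^ k h)" for w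
      using t(1) by (simp add: D_def vec_eq_iff)
    then show ?thesis by force
  qed
  moreover have "closed {w. f w = 0}"
    using contf[of UNIV] by (intro closed_Collect_eq) auto
  ultimately have "{w. f w = 0} \<in> null_sets lborel"
    by (simp add: negligible_iff_null_sets null_sets_completion_iff)
  then show ?thesis unfolding f_def by (rule AE_I') auto
qed

section \<open>Divergence on anisotropic boxes\<close>

lemma nn_integral_powr_abs_Icc:
  fixes p r :: real
  assumes "p > 0" "r \<ge> 0"
  shows "(\<integral>\<^sup>+x. ennreal (\<bar>x\<bar> powr (p - 1)) * indicator {-r..r} x \<partial>lborel) = ennreal (2 * r powr p / p)"
proof -
  let ?h = "\<lambda>x. ennreal (x powr (p - 1)) * indicator {0..r} x"
  let ?g = "\<lambda>x. ennreal ((- x) powr (p - 1)) * indicator {-r..0} x"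
  have 1: "(\<integral>\<^sup>+x. ?h x \<partial>lborel) = ennreal (r powr p / p)"
    using nn_integral_has_integral_lebesgue'[OF _ has_integral_powr_from_0[of "p - 1" r]] assms by simp
  have "(\<integral>\<^sup>+x. ?g x \<partial>lborel) = ennreal \<bar>-1\<bar> * (\<integral>\<^sup>+x. ?g (0 + (-1) * x) \<partial>lborel)"
    by (rule nn_integral_real_affine) auto
  also have "\<dots> = (\<integral>\<^sup>+x. ?h x \<partial>lborel)"
    by (auto intro!: nn_integral_cong simp: indicator_def)
  finally have 2: "(\<integral>\<^sup>+x. ?g x \<partial>lborel) = ennreal (r powr p / p)" using 1 by simp
  \<comment> \<open>Both half-intervals contain 0, but \<open>0 powr (p - 1) = 0\<close>, so the
    overlap is not counted twice.\<close>
  have "(\<integral>\<^sup>+x. ennreal (\<bar>x\<bar> powr (p - 1)) * indicator {-r..r} x \<partial>lborel)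
      = (\<integral>\<^sup>+x. ?h x + ?g x \<partial>lborel)"
    using assms by (intro nn_integral_cong) (auto simp: indicator_def)
  also have "\<dots> = ennreal (r powr p / p) + ennreal (r powr p / p)"
    by (subst nn_integral_add) (simp_all add: 1 2)
  also have "\<dots> = ennreal (2 * r powr p / p)"
    using assms by (simp flip: ennreal_plus)
  finally show ?thesis .
qed

text \<open>The half-widths vary by coordinate, so that the cube and the anisotropic boxes of the
  divergence argument belong to one family.\<close>

definition symm_box :: "real ^ 'd \<Rightarrow> (real ^ 'd) set"
  where "symm_box r = {w. \<forall>h. \<bar>w $ h\<bar> \<le> r $ h}"

lemma prod_Basis_vec:
  fixes g :: "real ^ 'd \<Rightarrow> 'a :: comm_monoid_mult"
  shows "(\<Prod>b\<in>(Basis :: (real ^ 'd) set). g b) = (\<Prod>h\<in>UNIV. g (axis h 1))"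
proof -
  have "(Basis :: (real ^ 'd) set) = range (\<lambda>h. axis h 1)"
    by (auto simp: Basis_vec_def)
  then have "(\<Prod>b\<in>(Basis :: (real ^ 'd) set). g b) = prod g (range (\<lambda>h. axis h 1))"
    by (rule arg_cong)
  also have "\<dots> = (\<Prod>h\<in>UNIV. g (axis h 1))"
    by (subst prod.reindex) (auto simp: inj_def axis_eq_axis)
  finally show ?thesis .
qed

text \<open>Weight and indicator both factor over the coordinates, so Tonelli reduces the integral
  to the one-variable case.\<close>

lemma nn_integral_abs_monom_symm_box:
  fixes s r :: "real ^ 'd"
  assumes s: "\<And>h. s $ h > 0" and r: "\<And>h. r $ h \<ge> 0"
  shows "(\<integral>\<^sup>+w. ennreal (abs_monom_real (s - 1) w) * indicator (symm_box r) w \<partial>lborel)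
    = ennreal (\<Prod>h\<in>UNIV. 2 * (r $ h) powr (s $ h) / s $ h)"
proof -
  define F :: "real ^ 'd \<Rightarrow> real \<Rightarrow> ennreal" where "F b x =
    ennreal (\<bar>x\<bar> powr (s \<bullet> b - 1)) * indicator {- (r \<bullet> b)..r \<bullet> b} x" for b x
  have ind: "indicator (symm_box r) w = (\<Prod>h\<in>UNIV. indicator {- r $ h..r $ h} (w $ h) :: ennreal)" for w
    by (auto simp: symm_box_def indicator_def abs_le_iff minus_le_iff prod.neutral)
  have "(\<integral>\<^sup>+w. ennreal (abs_monom_real (s - 1) w) * indicator (symm_box r) w \<partial>lborel)
    = (\<integral>\<^sup>+w. (\<Prod>b\<in>Basis. F b (w \<bullet> b)) \<partial>lborel)"
    by (intro nn_integral_cong)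
      (simp add: prod_Basis_vec F_def inner_axis prod.distrib ind abs_monom_real_def prod_ennreal)
  also have "\<dots> = (\<Prod>b\<in>Basis. (\<integral>\<^sup>+x. F b x \<partial>lborel))"
    by (rule nn_integral_lborel_prod) (auto simp: F_def)
  also have "\<dots> = (\<Prod>h\<in>UNIV. ennreal (2 * (r $ h) powr (s $ h) / s $ h))"
    unfolding prod_Basis_vec F_def using s r
    by (simp add: inner_axis nn_integral_powr_abs_Icc)
  also have "\<dots> = ennreal (\<Prod>h\<in>UNIV. 2 * (r $ h) powr (s $ h) / s $ h)"
    using s by (intro prod_ennreal) (simp add: less_imp_le)
  finally show ?thesis .
qed

lemma abs_monom_real_nonneg [simp]: "abs_monom_real e w \<ge> 0"
  by (simp add: abs_monom_real_def prod_nonneg)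

lemma abs_monom_real_measurable [measurable]: "abs_monom_real e \<in> borel_measurable borel"
  unfolding abs_monom_real_def by measurable

lemma symm_box_measurable [measurable]: "symm_box r \<in> sets borel"
proof -
  have "closed (symm_box r)"
    unfolding symm_box_def by (intro closed_Collect_all closed_Collect_le continuous_intros)
  then show ?thesis by simp
qed

lemma cube_eq_symm_box: "cube M = symm_box (\<chi> h. M)"
  by (auto simp: cube_def symm_box_def abs_le_iff minus_le_iff)

text \<open>The exponent \<open>- (1 / V)\<close> is critical: at scale \<open>t\<close> the factor
  \<open>\<bar>f w\<bar> powr (- (1 / V))\<close> is at least a constant over \<open>t\<close>,
  which exactly compensates the weighted volume, of order \<open>t\<close> by
  \<open>bs\<close>.\<close>

lemma nn_integral_powr_symm_box_eq_top:
  fixes b s :: "real ^ 'd" and f :: "real ^ 'd \<Rightarrow> real"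
  assumes f[measurable]: "f \<in> borel_measurable borel" and f_nz: "AE w in lborel. f w \<noteq> 0"
    and s: "\<And>h. s $ h > 0" and b: "\<And>h. b $ h \<ge> 0" and bs: "(\<Sum>h\<in>UNIV. b $ h * s $ h) = 1"
    and V: "V > 0" and C: "C > 0"
    and f_le: "\<And>t w. 0 < t \<Longrightarrow> t \<le> 1 \<Longrightarrow> w \<in> symm_box (\<chi> h. t powr b $ h) \<Longrightarrow> \<bar>f w\<bar> \<le> C * t powr V"
  shows "(\<integral>\<^sup>+w. ennreal (abs_monom_real (s - 1) w * \<bar>f w\<bar> powr (- (1 / V))) *
    indicator (symm_box (\<chi> h. 1)) w \<partial>lborel) = \<infinity>"
proof (rule ccontr)
  define g where "g = abs_monom_real (s - 1)"
  define q where "q w = ennreal (g w * \<bar>f w\<bar> powr (- (1 / V)))" for w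
  define B where "B t = symm_box (\<chi> h. t powr b $ h)" for t
  define P where "P = (\<Prod>h\<in>UNIV. 2 / s $ h)"
  have P: "P > 0" unfolding P_def using s by (intro prod_pos) auto
  have [measurable]: "B t \<in> sets borel" "g \<in> borel_measurable borel" for t
    by (simp_all add: B_def g_def)
  have [measurable]: "q \<in> borel_measurable borel" unfolding q_def by measurable
  have B1: "B 1 = symm_box (\<chi> h. 1)" by (simp add: B_def)
  have B_mono: "B t \<subseteq> B 1" if "0 < t" "t \<le> 1" for t
    unfolding B_def symm_box_def using that b powr_mono2[of "b $ h" t 1 for h]
    by (fastforce intro: order_trans)
  assume "\<not> ?thesis"
  then have fin: "(\<integral>\<^sup>+w. q w * indicator (B 1) w \<partial>lborel) < \<infinity>"
    by (simp add: q_def g_def B1 less_top)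
  have lower: "ennreal (C powr (- (1 / V)) * P) \<le> (\<integral>\<^sup>+w. q w * indicator (B t) w \<partial>lborel)"
    if t: "0 < t" "t \<le> 1" for t
  proof -
    define k where "k = C powr (- (1 / V)) / t"
    have k: "k \<ge> 0" using t by (simp add: k_def)
    have k_eq: "k = (C * t powr V) powr (- (1 / V))"
      using C t V by (simp add: k_def powr_mult powr_powr powr_minus divide_inverse)
    have "(\<integral>\<^sup>+w. ennreal (g w) * indicator (B t) w \<partial>lborel) = ennreal (\<Prod>h\<in>UNIV. 2 * (t powr b $ h) powr (s $ h) / s $ h)"
      unfolding g_def B_def using s by (subst nn_integral_abs_monom_symm_box) auto
    also have "(\<Prod>h\<in>UNIV. 2 * (t powr b $ h) powr (s $ h) / s $ h) = P * (\<Prod>h\<in>UNIV. t powr (b $ h * s $ h))"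
      by (simp add: P_def powr_powr flip: prod.distrib)
    also have "\<dots> = P * t" using t bs by (simp flip: powr_sum)
    finally have g_int: "(\<integral>\<^sup>+w. ennreal (g w) * indicator (B t) w \<partial>lborel) = ennreal (P * t)" .
    have "ennreal (C powr (- (1 / V)) * P) = ennreal k * ennreal (P * t)"
      using t P k by (simp add: k_def flip: ennreal_mult)
    also have "\<dots> = (\<integral>\<^sup>+w. ennreal k * (ennreal (g w) * indicator (B t) w) \<partial>lborel)"
      by (subst nn_integral_cmult) (auto simp: g_int)
    also have "\<dots> \<le> (\<integral>\<^sup>+w. q w * indicator (B t) w \<partial>lborel)"
    proof (rule nn_integral_mono_AE)
      show "AE w in lborel. ennreal k * (ennreal (g w) * indicator (B t) w) \<le> q w * indicator (B t) w"
        using f_nz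
      proof eventually_elim
        case (elim w)
        \<comment> \<open>For a negative exponent \<open>powr\<close> decreases on positive bases,
          but \<open>0 powr x = 0\<close>: the lower bound \<open>k\<close> fails at zeros of
          \<open>f\<close>, which \<open>f_nz\<close> discards.\<close>
        have "k * g w \<le> g w * \<bar>f w\<bar> powr (- (1 / V))" if "w \<in> B t"
        proof -
          have "\<bar>f w\<bar> \<le> C * t powr V" using f_le t that by (simp add: B_def)
          then have "k \<le> \<bar>f w\<bar> powr (- (1 / V))"
            unfolding k_eq using elim V by (intro powr_mono2') auto
          then show ?thesis unfolding g_def by (subst mult.commute) (intro mult_left_mono, simp_all)
        qed
        then show ?case using k by (auto simp: indicator_def q_def g_def simp flip: ennreal_mult intro!: ennreal_leI)
      qed
    qed
    finally show ?thesis .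
  qed
  define t where "t i = inverse (real (Suc i))" for i
  have t: "0 < t i" "t i \<le> 1" for i by (auto simp: t_def inverse_le_1_iff)
  \<comment> \<open>One such coordinate suffices: as \<open>t\<close> tends to 0 the boxes collapse
    into the null hyperplane \<open>w $ h = 0\<close>, even if other half-widths stay 1. Dominated
    convergence then sends the integrals to 0, against the fixed lower bound.\<close>
  have "\<exists>h. b $ h > 0"
  proof (rule ccontr)
    assume "\<nexists>h. b $ h > 0"
    then have "b $ h = 0" for h using b[of h] by (metis order_le_less)
    with bs show False by simp
  qed
  then obtain h where h: "b $ h > 0" by blast
  have "(\<lambda>i. \<integral>\<^sup>+w. q w * indicator (B (t i)) w \<partial>lborel) \<longlonglongrightarrow> (\<integral>\<^sup>+(w :: real ^ 'd). 0 \<partial>lborel)"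
  proof (rule nn_integral_dominated_convergence[OF _ _ _ _ fin])
    show "AE w in lborel. q w * indicator (B (t i)) w \<le> q w * indicator (B 1) w" for i
      using B_mono[OF t[of i]] by (auto simp: indicator_def)
    show "AE w in lborel. (\<lambda>i. q w * indicator (B (t i)) w) \<longlonglongrightarrow> 0"
      using AE_vec_nth_nonzero[of h]
    proof eventually_elim
      case (elim w)
      have "(\<lambda>i. t i powr b $ h) \<longlonglongrightarrow> 0 powr b $ h"
        unfolding t_def using h by (intro tendsto_powr' LIMSEQ_inverse_real_of_nat tendsto_const) auto
      then have "eventually (\<lambda>i. t i powr b $ h < \<bar>w $ h\<bar>) sequentially"
        using elim by (intro order_tendstoD(2)) auto
      then have "eventually (\<lambda>i. q w * indicator (B (t i)) w = 0) sequentially"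
        by eventually_elim (auto simp: B_def symm_box_def indicator_def not_le)
      then show ?case by (rule tendsto_eventually)
    qed
  qed measurable
  then have "ennreal (C powr (- (1 / V)) * P) \<le> 0"
    using lower t by (intro LIMSEQ_le_const) auto
  moreover have "C powr (- (1 / V)) * P > 0" using C P by simp
  ultimately show False by (simp only: ennreal_eq_0_iff le_zero_eq)
qed

text \<open>On the box a monomial is at most \<open>t\<close> raised to its
  \<open>b\<close>-weighted degree; as \<open>t \<le> 1\<close>, the lower bound \<open>V\<close> on
  these degrees bounds it by \<open>t powr V\<close>.\<close>

lemma abs_sum_monom_nat_le:
  fixes a :: "nat \<Rightarrow> nat ^ 'd"
  assumes t: "0 < t" "t \<le> 1" and w: "w \<in> symm_box (\<chi> h. t powr b $ h)"
    and V: "\<And>j. j \<in> J \<Longrightarrow> V \<le> (\<Sum>h\<in>UNIV. b $ h * real (a j $ h))"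
  shows "\<bar>\<Sum>j\<in>J. c j * monom_nat (a j) w\<bar> \<le> (\<Sum>j\<in>J. \<bar>c j\<bar>) * t powr V"
proof -
  have "\<bar>monom_nat (a j) w\<bar> \<le> t powr V" if "j \<in> J" for j
  proof -
    have "\<bar>monom_nat (a j) w\<bar> = (\<Prod>h\<in>UNIV. \<bar>w $ h\<bar> ^ (a j $ h))"
      by (simp add: monom_nat_def abs_prod power_abs)
    also have "\<dots> \<le> (\<Prod>h\<in>UNIV. (t powr b $ h) ^ (a j $ h))"
      using w by (intro prod_mono) (auto simp: symm_box_def intro: power_mono)
    also have "\<dots> = (\<Prod>h\<in>UNIV. t powr (b $ h * real (a j $ h)))"
      using t by (simp add: powr_powr flip: powr_realpow)
    also have "\<dots> = t powr (\<Sum>h\<in>UNIV. b $ h * real (a j $ h))"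
      using t by (simp add: powr_sum)
    also have "\<dots> \<le> t powr V" using t V[OF that] by (intro powr_mono') auto
    finally show ?thesis .
  qed
  then have "(\<Sum>j\<in>J. \<bar>c j * monom_nat (a j) w\<bar>) \<le> (\<Sum>j\<in>J. \<bar>c j\<bar> * t powr V)"
    by (intro sum_mono) (simp add: abs_mult mult_left_mono)
  then show ?thesis
    unfolding sum_distrib_right by (rule order_trans[OF sum_abs])
qed

section \<open>The maximum pole of the zeta function\<close>

lemma neg_max_pole_eq:
  assumes "is_max_pole F r"
  shows "neg_max_pole F = ereal (- r)"
proof -
  have "(THE r. is_max_pole F r) = r"
  proof (rule the_equality[where P = "is_max_pole F", OF assms])
    fix r' assume "is_max_pole F r'"
    then have "r' \<le> r" "r \<le> r'"
      using assms unfolding is_max_pole_def by (metis Re_complex_of_real)+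
    then show "r' = r" by simp
  qed
  moreover have "\<exists>p. is_pole F p" using assms unfolding is_max_pole_def by blast
  ultimately show ?thesis unfolding neg_max_pole_def by simp
qed

text \<open>The factor has no zeros and is inverted by \<open>exp (- k * z)\<close>. This permits
  rescaling \<open>f\<close> by a constant, which multiplies the zeta function by an exponential,
  without moving poles.\<close>

lemma is_pole_exp_mult_iff:
  fixes F :: "complex \<Rightarrow> complex"
  shows "is_pole (\<lambda>z. exp (k * z) * F z) p \<longleftrightarrow> is_pole F p"
proof
  assume "is_pole F p"
  then show "is_pole (\<lambda>z. exp (k * z) * F z) p"
    by (rule is_pole_mult_analytic_nonzero1[where f = "\<lambda>z. exp (k * z)"]) (auto intro!: analytic_intros)
next
  assume "is_pole (\<lambda>z. exp (k * z) * F z) p"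
  then have "is_pole (\<lambda>z. exp (- k * z) * (exp (k * z) * F z)) p"
    by (rule is_pole_mult_analytic_nonzero1[where f = "\<lambda>z. exp (- k * z)"]) (auto intro!: analytic_intros)
  then show "is_pole F p" by (simp flip: mult.assoc exp_add)
qed

text \<open>With \<open>K\<close> bounding \<open>\<bar>f\<bar>\<close> on the cube,
  \<open>\<psi> = ln K - ln \<bar>f\<bar>\<close> is nonnegative, and for \<open>Re z > 0\<close>
  the quotient of \<open>\<zeta> z\<close> by \<open>K\<close> to the power \<open>z\<close> is the
  Laplace transform of \<open>\<psi>\<close> under the finite measure with density \<open>g\<close>
  on the cube. Landau's theorem then turns divergence at \<open>x\<close> into a maximum pole at or
  to the right of \<open>x\<close>.\<close>

lemma zeta_max_pole_of_divergent:
  fixes f :: "real ^ 'd \<Rightarrow> real" and s :: "real ^ 'd"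
  assumes cont: "continuous_on UNIV f" and f_nz: "AE w in lborel. f w \<noteq> 0"
    and s: "\<And>h. s $ h > 0" and M: "M \<ge> 1"
    and div: "(\<integral>\<^sup>+w. ennreal (abs_monom_real (s - 1) w * \<bar>f w\<bar> powr x) *
      indicator (symm_box (\<chi> h. 1)) w \<partial>lborel) = \<infinity>"
    and mero: "meromorphic_continuation \<zeta> (zeta_integral (cube M) f (abs_monom_real (s - 1)))"
  shows "\<exists>r\<ge>x. is_max_pole \<zeta> r"
proof -
  define g where "g = abs_monom_real (s - 1)"
  have [measurable]: "f \<in> borel_measurable borel" using cont by (rule borel_measurable_continuous_onI)
  have [measurable]: "g \<in> borel_measurable borel" by (simp add: g_def)
  have g0: "g w \<ge> 0" for w by (simp add: g_def)
  have [measurable]: "cube M \<in> sets (borel :: (real ^ 'd) measure)" by (simp add: cube_eq_symm_box)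
  have "compact (cube M :: (real ^ 'd) set)"
  proof -
    have "(cube M :: (real ^ 'd) set) = cbox (\<chi> h. - M) (\<chi> h. M)"
      by (auto simp: cube_def mem_box_cart)
    then show ?thesis by simp
  qed
  then have "bounded (f ` cube M)"
    by (intro compact_imp_bounded compact_continuous_image continuous_on_subset[OF cont]) auto
  then obtain K where K: "K > 0" "\<And>w. w \<in> cube M \<Longrightarrow> \<bar>f w\<bar> \<le> K"
    unfolding bounded_pos by auto
  define p where "p w = indicator (cube M) w * g w" for w
  define N where "N = density lborel (\<lambda>w. ennreal (p w))"
  have [measurable]: "p \<in> borel_measurable borel" unfolding p_def by measurable
  have p0: "p w \<ge> 0" for w using g0 by (simp add: p_def)
  \<comment> \<open>The default 0 keeps \<open>\<psi>\<close> nonnegative everywhere, as the Laplace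
    lemmas require. It is harmless: the complement of the cube and the zeros of \<open>f\<close> are
    null for \<open>N\<close>.\<close>
  define \<psi> where "\<psi> w = (if w \<in> cube M \<and> f w \<noteq> 0 then ln K - ln \<bar>f w\<bar> else 0)" for w
  have \<psi>_meas: "\<psi> \<in> borel_measurable borel" unfolding \<psi>_def by measurable
  then have [measurable]: "\<psi> \<in> borel_measurable N" by (simp add: N_def)
  have \<psi>0: "\<psi> w \<ge> 0" for w using K by (simp add: \<psi>_def)
  have N: "finite_measure N"
  proof (rule finite_measureI)
    have "emeasure N (space N) = (\<integral>\<^sup>+w. ennreal (g w) * indicator (cube M) w \<partial>lborel)"
      unfolding N_def by (subst emeasure_density)
        (auto simp: p_def indicator_def intro!: nn_integral_cong)
    also have "\<dots> < \<infinity>"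
      unfolding g_def cube_eq_symm_box using s M by (subst nn_integral_abs_monom_symm_box) auto
    finally show "emeasure N (space N) \<noteq> \<infinity>" by simp
  qed
  define F where "F z = exp (- of_real (ln K) * z) * \<zeta> z" for z
  have F_mero: "F meromorphic_on UNIV"
    unfolding F_def
  proof (rule meromorphic_on_mult)
    show "(\<lambda>z. exp (- of_real (ln K) * z)) meromorphic_on UNIV"
      by (intro analytic_on_imp_meromorphic_on analytic_intros)
    show "\<zeta> meromorphic_on UNIV" using mero by (simp add: meromorphic_continuation_def)
  qed
  have F_eq: "F z = (\<integral>w. exp (- z * of_real (\<psi> w)) \<partial>N)" if z: "Re z > 0" for z
  proof -
    have "\<zeta> z = (LINT w|lborel. indicator (cube M) w *\<^sub>R (complex_of_real \<bar>f w\<bar> powr z * complex_of_real (g w)))"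
      using mero z by (simp add: meromorphic_continuation_def zeta_integral_def set_lebesgue_integral_def g_def)
    then have "F z = (LINT w|lborel. exp (- of_real (ln K) * z) *
        (indicator (cube M) w *\<^sub>R (complex_of_real \<bar>f w\<bar> powr z * complex_of_real (g w))))"
      by (simp only: F_def integral_mult_right_zero)
    also have "\<dots> = (LINT w|lborel. p w *\<^sub>R exp (- z * of_real (\<psi> w)))"
    proof (rule integral_cong_AE)
      show "AE w in lborel. exp (- of_real (ln K) * z) *
          (indicator (cube M) w *\<^sub>R (complex_of_real \<bar>f w\<bar> powr z * complex_of_real (g w)))
        = p w *\<^sub>R exp (- z * of_real (\<psi> w))"
        using f_nz
      proof eventually_elim
        case (elim w)
        have "exp (- of_real (ln K) * z) * complex_of_real \<bar>f w\<bar> powr z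
            = exp (- z * of_real (ln K - ln \<bar>f w\<bar>))"
          using elim by (simp add: powr_def Ln_of_real algebra_simps flip: exp_add)
        then show ?case using elim
          by (auto simp: p_def \<psi>_def indicator_def scaleR_conv_of_real simp flip: mult.assoc)
      qed
    qed (use \<psi>_meas in measurable)
    also have "\<dots> = (\<integral>w. exp (- z * of_real (\<psi> w)) \<partial>N)"
      unfolding N_def using p0 \<psi>_meas by (subst integral_density) auto
    finally show ?thesis .
  qed
  have "\<not> integrable N (\<lambda>w. exp (- x * \<psi> w))"
  proof
    assume "integrable N (\<lambda>w. exp (- x * \<psi> w))"
    then have "integrable lborel (\<lambda>w. p w * exp (- x * \<psi> w))"
      unfolding N_def using p0 \<psi>_meas by (subst (asm) integrable_density) auto
    \<comment> \<open>Multiplying by \<open>K powr x\<close> undoes the normalisation: almost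
      everywhere on the cube the integrand becomes \<open>g w * \<bar>f w\<bar> powr x\<close>, and
      the cube contains the unit box as \<open>M \<ge> 1\<close>.\<close>
    then have "integrable lborel (\<lambda>w. K powr x * (p w * exp (- x * \<psi> w)))"
      by (intro integrable_mult_right)
    then have "(\<integral>\<^sup>+w. ennreal (K powr x * (p w * exp (- x * \<psi> w))) \<partial>lborel) < \<infinity>"
      using p0 by (subst nn_integral_eq_integral) simp_all
    moreover have "(\<integral>\<^sup>+w. ennreal (g w * \<bar>f w\<bar> powr x) * indicator (symm_box (\<chi> h. 1)) w \<partial>lborel)
      \<le> (\<integral>\<^sup>+w. ennreal (K powr x * (p w * exp (- x * \<psi> w))) \<partial>lborel)"
    proof (rule nn_integral_mono_AE)
      show "AE w in lborel. ennreal (g w * \<bar>f w\<bar> powr x) * indicator (symm_box (\<chi> h. 1)) w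
        \<le> ennreal (K powr x * (p w * exp (- x * \<psi> w)))"
        using f_nz
      proof eventually_elim
        case (elim w)
        have "K powr x * exp (- x * (ln K - ln \<bar>f w\<bar>)) = \<bar>f w\<bar> powr x"
          using elim K by (simp add: powr_def algebra_simps flip: exp_add)
        moreover have "w \<in> cube M" if "w \<in> symm_box (\<chi> h. 1)"
          using that M unfolding cube_eq_symm_box symm_box_def by (auto intro: order_trans)
        ultimately show ?case using elim g0[of w]
          by (auto simp: p_def \<psi>_def indicator_def mult_ac)
      qed
    qed
    ultimately show False using div by (simp add: g_def)
  qed
  from laplace_meromorphic_max_pole[OF N _ \<psi>0 F_mero F_eq this]
  obtain r where r: "r \<ge> x" "is_max_pole F r" by auto
  have "is_max_pole \<zeta> r"
    using r(2) unfolding is_max_pole_def F_def is_pole_exp_mult_iff .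
  with r(1) show ?thesis by blast
qed

theorem corollary4p1:
  fixes n :: nat
    and c :: "nat \<Rightarrow> real"
    and a :: "nat \<Rightarrow> nat ^ 'd"
    and s :: "real ^ 'd"
    and f :: "real ^ 'd \<Rightarrow> real"
  assumes "n \<ge> 1"
    and "\<forall>j\<in>{1..n}. c j \<noteq> 0"
    and "inj_on a {1..n}"
    and "\<forall>w. f w = (\<Sum>j=1..n. c j * monom_nat (a j) w)"
    and "\<forall>h. s $ h > 0"
  shows "\<forall>\<^sub>F M in at_top. \<forall>\<zeta>.
    meromorphic_continuation \<zeta> (zeta_integral (cube M) f (abs_monom_real (s - 1))) \<longrightarrow>
    neg_max_pole \<zeta> \<le> lambda_smplx n a s"
proof -
  define V where "V = smplx_value n a s"
  obtain \<alpha> where \<alpha>: "\<alpha> \<in> std_simplex" "V = weight_min n a s \<alpha>"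
    using smplx_value_attained[OF assms(1), of a s] by (auto simp: V_def)
  \<comment> \<open>Dividing by \<open>s\<close> serves both needs: the \<open>b $ h * s $ h\<close>
    sum to 1, and the \<open>b\<close>-weighted degree of a monomial is the linear form minimised in
    \<open>weight_min\<close>.\<close>
  define b where "b = (\<chi> h. \<alpha> $ h / s $ h)"
  have s: "s $ h > 0" for h using assms(5) by simp
  have b: "b $ h \<ge> 0" for h
    using \<alpha>(1) s[of h] by (simp add: b_def std_simplex_def)
  have "b $ h * s $ h = \<alpha> $ h" for h using s[of h] by (simp add: b_def)
  then have bs: "(\<Sum>h\<in>UNIV. b $ h * s $ h) = 1"
    using \<alpha>(1) by (simp add: std_simplex_def)
  have V_min: "V = (MIN j\<in>{1..n}. \<Sum>h\<in>UNIV. b $ h * real (a j $ h))"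
    unfolding \<alpha>(2) weight_min_def b_def by simp
  have V_le: "V \<le> (\<Sum>h\<in>UNIV. b $ h * real (a j $ h))" if "j \<in> {1..n}" for j
    unfolding V_min using that by (intro Min_le) auto
  have V0: "V \<ge> 0"
    unfolding V_min using assms(1) b by (subst Min_ge_iff) (auto intro!: sum_nonneg)
  show ?thesis
  proof (cases "V = 0")
    case True
    then show ?thesis by (simp add: lambda_smplx_def V_def)
  next
    case False
    with V0 have V: "V > 0" by simp
    define C where "C = (\<Sum>j=1..n. \<bar>c j\<bar>)"
    have C: "C > 0"
      unfolding C_def using assms(1,2) by (intro sum_pos) auto
    have f_eq: "f = (\<lambda>w. \<Sum>j=1..n. c j * monom_nat (a j) w)" using assms(4) by auto
    have cont: "continuous_on UNIV f" unfolding f_eq by (intro continuous_intros)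
    have f_nz: "AE w in lborel. f w \<noteq> 0"
      unfolding f_eq using assms(1-3) by (intro AE_sum_monom_nat_nonzero) auto
    have div: "(\<integral>\<^sup>+w. ennreal (abs_monom_real (s - 1) w * \<bar>f w\<bar> powr (- (1 / V))) *
      indicator (symm_box (\<chi> h. 1)) w \<partial>lborel) = \<infinity>"
    proof (rule nn_integral_powr_symm_box_eq_top[OF _ f_nz s b bs V C])
      show "f \<in> borel_measurable borel" using cont by (rule borel_measurable_continuous_onI)
      show "\<bar>f w\<bar> \<le> C * t powr V" if "0 < t" "t \<le> 1" "w \<in> symm_box (\<chi> h. t powr b $ h)" for t w
        unfolding f_eq C_def using that V_le by (intro abs_sum_monom_nat_le) auto
    qed
    show ?thesis
    \<comment> \<open>\<open>M \<ge> 1\<close> is large enough, since the divergence already occurs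
      in the unit box.\<close>
    proof (intro eventually_mono[OF eventually_ge_at_top[of 1]] allI impI)
      fix M \<zeta>
      assume "M \<ge> 1"
        and "meromorphic_continuation \<zeta> (zeta_integral (cube M) f (abs_monom_real (s - 1)))"
      from zeta_max_pole_of_divergent[OF cont f_nz s this(1) div this(2)]
      obtain r where "r \<ge> - (1 / V)" "is_max_pole \<zeta> r" by blast
      then show "neg_max_pole \<zeta> \<le> lambda_smplx n a s"
        using False by (simp add: neg_max_pole_eq lambda_smplx_def V_def)
    qed
  qed
qed

end
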